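(* In the graceful game on the cycle $C_n$, Bob has a winning strategy for every $n\geq 4$, and Alice has a winning strategy on $C_3$ (no matter who starts).
   Context: $C_n$ denotes the cycle on $n\geq 3$ vertices. A graceful labeling of a graph $G$ with $m$ edges is an injective map $f\colon V(G)\to\{0,1,\dots,m\}$ such that the induced edge labels $|f(u)-f(v)|$, $uv\in E(G)$, are pairwise distinct. The graceful game on a simple graph $G$ with $m$ edges: two players, Alice and Bob, alternately choose a free (not yet labeled) vertex and assign to it a label from $\{0,1,\dots,m\}$ not yet used. An edge both of whose endpoints are labeled gets label $|f(u)-f(v)|$; a move is legal only if after it all edge labels are pairwise distinct. Alice wins if the whole graph ends up gracefully labeled; Bob wins if he can prevent this. Either player may be the first to move. *)

theory Defs
  imports Main
begin

text \<open>A graph is given by its vertex set \<open>V\<close> and its set \<open>E\<close> of two-element edges.\<close>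

definition simple_graph :: "'a set \<Rightarrow> 'a set set \<Rightarrow> bool" where
  "simple_graph V E \<longleftrightarrow> finite V \<and> (\<forall>e\<in>E. e \<subseteq> V \<and> card e = 2)"

definition cycle_verts :: "nat \<Rightarrow> nat set" where
  "cycle_verts n = {0..<n}"

definition cycle_edges :: "nat \<Rightarrow> nat set set" where
  "cycle_edges n = {{i, (i + 1) mod n} |i. i < n}"

definition distinct_edge_labels :: "'a set set \<Rightarrow> ('a \<Rightarrow> nat) \<Rightarrow> bool" where
  "distinct_edge_labels E f \<longleftrightarrow>
     (\<forall>u v x y. {u, v} \<in> E \<and> {x, y} \<in> E \<and> {u, v} \<noteq> {x, y} \<longrightarrow>
        \<bar>int (f u) - int (f v)\<bar> \<noteq> \<bar>int (f x) - int (f y)\<bar>)"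

definition graceful_labeling :: "'a set \<Rightarrow> 'a set set \<Rightarrow> ('a \<Rightarrow> nat) \<Rightarrow> bool" where
  "graceful_labeling V E f \<longleftrightarrow>
     inj_on f V \<and> f ` V \<subseteq> {0..card E} \<and> distinct_edge_labels E f"

datatype player = Alice | Bob

fun opponent :: "player \<Rightarrow> player" where
  "opponent Alice = Bob"
| "opponent Bob = Alice"

text \<open>A move assigns a label to a vertex. A position is the partial labeling reached so far;
  a play is the chronological list of moves, with associated position \<open>map_of ms\<close>
  (no vertex is labeled twice in a legal play).\<close>

type_synonym 'a move = "'a \<times> nat"

definition legal_move ::
    "'a set \<Rightarrow> 'a set set \<Rightarrow> ('a \<rightharpoonup> nat) \<Rightarrow> 'a move \<Rightarrow> bool" where
  "legal_move V E f mv \<longleftrightarrow>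
     (case mv of (v, l) \<Rightarrow>
        v \<in> V \<and> v \<notin> dom f \<and> l \<in> {0..card E} \<and> l \<notin> ran f \<and>
        distinct_edge_labels {e \<in> E. e \<subseteq> dom (f(v \<mapsto> l))} (the \<circ> f(v \<mapsto> l)))"

definition legal_play :: "'a set \<Rightarrow> 'a set set \<Rightarrow> 'a move list \<Rightarrow> bool" where
  "legal_play V E ms \<longleftrightarrow>
     (\<forall>i < length ms. legal_move V E (map_of (take i ms)) (ms ! i))"

text \<open>Legality does not depend on the player, so once the player to move has no legal move the
  position is blocked for both players. Hence a play is over exactly when no legal move is left.\<close>

definition finished_play :: "'a set \<Rightarrow> 'a set set \<Rightarrow> 'a move list \<Rightarrow> bool" where
  "finished_play V E ms \<longleftrightarrow>
     legal_play V E ms \<and> (\<nexists>mv. legal_move V E (map_of ms) mv)"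

definition winner :: "'a set \<Rightarrow> 'a set set \<Rightarrow> 'a move list \<Rightarrow> player" where
  "winner V E ms =
     (if dom (map_of ms) = V \<and> graceful_labeling V E (the \<circ> map_of ms) then Alice else Bob)"

definition to_move :: "player \<Rightarrow> 'a move list \<Rightarrow> player" where
  "to_move first ms = (if even (length ms) then first else opponent first)"

text \<open>A strategy must answer with a legal move whenever one exists; without this requirement a
  strategy proposing illegal moves would be vacuously winning.\<close>

definition strategy ::
    "'a set \<Rightarrow> 'a set set \<Rightarrow> player \<Rightarrow> player \<Rightarrow> ('a move list \<Rightarrow> 'a move) \<Rightarrow> bool" where
  "strategy V E first P \<sigma> \<longleftrightarrow>
     (\<forall>ms. legal_play V E ms \<and> to_move first ms = P \<and> (\<exists>mv. legal_move V E (map_of ms) mv)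
        \<longrightarrow> legal_move V E (map_of ms) (\<sigma> ms))"

definition consistent_with ::
    "player \<Rightarrow> player \<Rightarrow> ('a move list \<Rightarrow> 'a move) \<Rightarrow> 'a move list \<Rightarrow> bool" where
  "consistent_with first P \<sigma> ms \<longleftrightarrow>
     (\<forall>i < length ms. to_move first (take i ms) = P \<longrightarrow> ms ! i = \<sigma> (take i ms))"

definition has_winning_strategy ::
    "'a set \<Rightarrow> 'a set set \<Rightarrow> player \<Rightarrow> player \<Rightarrow> bool" where
  "has_winning_strategy V E first P \<longleftrightarrow>
     (\<exists>\<sigma>. strategy V E first P \<sigma> \<and>
        (\<forall>ms. finished_play V E ms \<and> consistent_with first P \<sigma> ms \<longrightarrow> winner V E ms = P))"

lemma simple_graph_cycle:
  assumes "n \<ge> 3"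
  shows "simple_graph (cycle_verts n) (cycle_edges n)"
proof -
  have "i \<noteq> (i + 1) mod n" if "i < n" for i
    using that assms by (cases "i + 1 = n") auto
  then show ?thesis
    using assms by (auto simp: simple_graph_def cycle_verts_def cycle_edges_def card_insert_if)
qed

lemma card_cycle_edges:
  assumes "n \<ge> 3"
  shows "card (cycle_edges n) = n"
proof -
  have suc: "(i + 1) mod n = (if i + 1 = n then 0 else i + 1)" if "i < n" for i
    using that by auto
  have "cycle_edges n = (\<lambda>i. {i, (i + 1) mod n}) ` {..<n}"
    by (auto simp: cycle_edges_def)
  moreover have "inj_on (\<lambda>i. {i, (i + 1) mod n}) {..<n}"
  proof (rule inj_onI)
    fix i j assume "i \<in> {..<n}" "j \<in> {..<n}" "{i, (i + 1) mod n} = {j, (j + 1) mod n}"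
    then show "i = j"
      using suc[of i] suc[of j] assms by (auto simp: doubleton_eq_iff split: if_splits)
  qed
  ultimately show ?thesis
    by (simp add: card_image)
qed

end

theory Submission
  imports Defs
begin

text \<open>
  Bob wins as soon as he reaches a position that no graceful labeling extends. Since \<open>C\<^sub>n\<close> has
  \<open>n\<close> edges, a graceful labeling realizes every edge label: \<open>0\<close> and \<open>n\<close> are adjacent, and
  \<open>n - 1\<close> occurs between \<open>0\<close> and \<open>n - 1\<close> or between \<open>1\<close> and \<open>n\<close>. For \<open>n \<ge> 5\<close>, Bob labels a
  vertex with \<open>0\<close> (next to Alice's first vertex if she starts, and up to replacing every label
  \<open>l\<close> by \<open>n - l\<close>). If Alice does not answer with \<open>n\<close> next to it, Bob separates \<open>0\<close> from \<open>n\<close>;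
  otherwise he makes the edge label \<open>n - 1\<close> impossible by placing \<open>1\<close> away from \<open>n\<close>. On \<open>C\<^sub>4\<close> a graceful
  labeling admits only few pairs of labels on opposite vertices, which Bob violates. On \<open>C\<^sub>3\<close> Alice
  only has to bring \<open>0\<close> or \<open>3\<close> into play by the second move.
\<close>

section \<open>Winning by an invariant\<close>

lemma map_of_snoc:
  assumes "v \<notin> dom (map_of ms)"
  shows "map_of (ms @ [(v, l)]) = (map_of ms)(v \<mapsto> l)"
  using assms by (auto simp: map_add_def fun_eq_iff split: option.splits)

lemma legal_play_snoc:
  "legal_play V E (ms @ [mv]) \<longleftrightarrow> legal_play V E ms \<and> legal_move V E (map_of ms) mv"
  by (auto simp: legal_play_def nth_append less_Suc_eq)

lemma consistent_with_snoc:
  "consistent_with first P \<sigma> (ms @ [mv]) \<longleftrightarrow>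
     consistent_with first P \<sigma> ms \<and> (to_move first ms = P \<longrightarrow> mv = \<sigma> ms)"
  by (auto simp: consistent_with_def nth_append less_Suc_eq)

text \<open>The strategy picks, by choice, a legal move that keeps \<open>I\<close> whenever
  \<open>I\<close> holds, so every consistent play satisfies \<open>I\<close> by induction on its
  last move.\<close>

lemma has_winning_strategyI:
  assumes init: "I []"
    and own: "\<And>ms mv. \<lbrakk>legal_play V E ms; I ms; to_move first ms = P;
        legal_move V E (map_of ms) mv\<rbrakk>
      \<Longrightarrow> \<exists>mv'. legal_move V E (map_of ms) mv' \<and> I (ms @ [mv'])"
    and other: "\<And>ms mv. \<lbrakk>legal_play V E ms; I ms; to_move first ms \<noteq> P;
        legal_move V E (map_of ms) mv\<rbrakk> \<Longrightarrow> I (ms @ [mv])"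
    and final: "\<And>ms. \<lbrakk>finished_play V E ms; I ms\<rbrakk> \<Longrightarrow> winner V E ms = P"
  shows "has_winning_strategy V E first P"
proof -
  \<comment> \<open>Preservation of \<open>I\<close> is conditional because \<open>strategy\<close>
    demands legal answers on all legal plays, including those where \<open>I\<close> fails.\<close>
  define good where
    "good ms mv \<longleftrightarrow> legal_move V E (map_of ms) mv \<and> (I ms \<longrightarrow> I (ms @ [mv]))" for ms mv
  define \<sigma> where "\<sigma> ms = (SOME mv. good ms mv)" for ms
  have good: "good ms (\<sigma> ms)"
    if "legal_play V E ms" "to_move first ms = P" "legal_move V E (map_of ms) mv" for ms mv
    unfolding \<sigma>_def by (rule someI_ex) (use own[OF that(1) _ that(2,3)] that(3) good_def in blast)
  have "strategy V E first P \<sigma>"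
    using good by (auto simp: strategy_def good_def)
  moreover have "I ms" if "legal_play V E ms" "consistent_with first P \<sigma> ms" for ms
    using that
  proof (induction ms rule: rev_induct)
    case Nil
    then show ?case by (simp add: init)
  next
    case (snoc mv ms)
    then have ms: "legal_play V E ms" "legal_move V E (map_of ms) mv" "I ms"
      and mv: "to_move first ms = P \<Longrightarrow> mv = \<sigma> ms"
      by (auto simp: legal_play_snoc consistent_with_snoc)
    show ?case
    proof (cases "to_move first ms = P")
      case True
      then show ?thesis
        using good[OF ms(1) True ms(2)] mv ms(3) by (auto simp: good_def)
    next
      case False
      then show ?thesis using other ms by blast
    qed
  qed
  ultimately show ?thesis
    using final by (auto simp: has_winning_strategy_def finished_play_def)
qed

section \<open>Positions from which Bob wins\<close>

definition extendable :: "'a set \<Rightarrow> 'a set set \<Rightarrow> ('a \<rightharpoonup> nat) \<Rightarrow> bool" where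
  "extendable V E f \<longleftrightarrow> (\<exists>g. graceful_labeling V E g \<and> (\<forall>v l. f v = Some l \<longrightarrow> g v = l))"

text \<open>Used contrapositively: once no graceful labeling extends a position, further moves
  cannot repair it. Freshness of \<open>v\<close> ensures that the update only adds a label.\<close>

lemma extendable_updD: "extendable V E (f(v \<mapsto> l)) \<Longrightarrow> v \<notin> dom f \<Longrightarrow> extendable V E f"
  unfolding extendable_def by (metis domI fun_upd_other)

text \<open>Backward induction on the game tree, with positions beyond graceful extension as leaves.
  In \<open>Alice_moves\<close>, \<open>dom f \<noteq> V\<close> rules out completed positions,
  where the second premise holds vacuously; an incomplete position that blocks Alice rightly counts
  for Bob.\<close>

inductive bob_wins :: "'a set \<Rightarrow> 'a set set \<Rightarrow> player \<Rightarrow> ('a \<rightharpoonup> nat) \<Rightarrow> bool" for V E where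
  doomed: "\<not> extendable V E f \<Longrightarrow> bob_wins V E q f"
| Bob_moves: "\<lbrakk>legal_move V E f (v, l); bob_wins V E Alice (f(v \<mapsto> l))\<rbrakk> \<Longrightarrow> bob_wins V E Bob f"
| Alice_moves: "\<lbrakk>dom f \<noteq> V; \<And>v l. legal_move V E f (v, l) \<Longrightarrow> bob_wins V E Bob (f(v \<mapsto> l))\<rbrakk>
    \<Longrightarrow> bob_wins V E Alice f"

text \<open>A complete graceful labeling extends itself, leaves Bob no free vertex and violates
  \<open>dom f \<noteq> V\<close>, so each of the three rules fails.\<close>

lemma bob_wins_not_won_by_Alice:
  assumes "bob_wins V E q f" "dom f = V" "graceful_labeling V E (the \<circ> f)"
  shows False
  using assms
proof cases
  case doomed
  then show False using assms(3) by (auto simp: extendable_def)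
next
  case (Bob_moves v l)
  then show False using assms(2) by (auto simp: legal_move_def)
next
  case Alice_moves
  then show False using assms(2) by simp
qed

lemma to_move_snoc: "to_move first (ms @ [mv]) = opponent (to_move first ms)"
  by (cases first) (auto simp: to_move_def)

lemma bob_wins_has_winning_strategy:
  assumes "bob_wins V E first Map.empty"
  shows "has_winning_strategy V E first Bob"
proof (rule has_winning_strategyI[where I = "\<lambda>ms. bob_wins V E (to_move first ms) (map_of ms)"])
  show "bob_wins V E (to_move first []) (map_of [])"
    using assms by (simp add: to_move_def)
next
  fix ms :: "'a move list" and mv
  assume win: "bob_wins V E (to_move first ms) (map_of ms)" and Bob: "to_move first ms = Bob"
    and mv: "legal_move V E (map_of ms) mv"
  obtain v l where mv': "legal_move V E (map_of ms) (v, l)"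
    and "bob_wins V E Alice ((map_of ms)(v \<mapsto> l))"
  proof -
    from win show thesis
    proof cases
      \<comment> \<open>Any legal move keeps a doomed position doomed; \<open>mv\<close> supplies
        one.\<close>
      case doomed
      obtain v l where vl: "mv = (v, l)" by (cases mv)
      then have "v \<notin> dom (map_of ms)" using mv by (simp add: legal_move_def)
      with doomed have "\<not> extendable V E ((map_of ms)(v \<mapsto> l))"
        using extendable_updD by metis
      then show thesis using that mv vl bob_wins.doomed by metis
    qed (use Bob that in auto)
  qed
  then show "\<exists>mv'. legal_move V E (map_of ms) mv' \<and>
      bob_wins V E (to_move first (ms @ [mv'])) (map_of (ms @ [mv']))"
    using Bob by (intro exI[of _ "(v, l)"])
      (auto simp: map_of_snoc to_move_snoc legal_move_def simp del: map_of_append)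
next
  fix ms :: "'a move list" and mv
  assume win: "bob_wins V E (to_move first ms) (map_of ms)" and "to_move first ms \<noteq> Bob"
    and mv: "legal_move V E (map_of ms) mv"
  then have Alice: "to_move first ms = Alice" by (cases "to_move first ms") auto
  obtain v l where vl: "mv = (v, l)" by (cases mv)
  then have free: "v \<notin> dom (map_of ms)" using mv by (simp add: legal_move_def)
  from win have "bob_wins V E Bob ((map_of ms)(v \<mapsto> l))"
  proof cases
    case doomed
    then show ?thesis using free extendable_updD bob_wins.doomed by metis
  qed (use Alice mv vl in auto)
  then show "bob_wins V E (to_move first (ms @ [mv])) (map_of (ms @ [mv]))"
    using Alice free vl by (simp add: map_of_snoc to_move_snoc del: map_of_append)
next
  fix ms :: "'a move list"
  assume "bob_wins V E (to_move first ms) (map_of ms)"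
  then show "winner V E ms = Bob"
    using bob_wins_not_won_by_Alice unfolding winner_def by metis
qed

section \<open>Symmetries\<close>

text \<open>\<open>p\<close> is a graph automorphism extended to a permutation of the whole type;
  \<open>c\<close> is an involution preserving differences of admissible labels, such as the
  identity or the complement.\<close>

locale game_symmetry =
  fixes V :: "'a set" and E :: "'a set set" and p :: "'a \<Rightarrow> 'a" and c :: "nat \<Rightarrow> nat"
  assumes bij_p: "bij p"
    and p_V: "p v \<in> V \<longleftrightarrow> v \<in> V"
    and E_V: "e \<in> E \<Longrightarrow> e \<subseteq> V"
    and p_E: "p ` e \<in> E \<longleftrightarrow> e \<in> E"
    and c_c: "c (c l) = l"
    and c_le: "l \<le> card E \<Longrightarrow> c l \<le> card E"
    and c_dist: "\<lbrakk>k \<le> card E; l \<le> card E\<rbrakk>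
      \<Longrightarrow> \<bar>int (c k) - int (c l)\<bar> = \<bar>int k - int l\<bar>"
begin

text \<open>Pulls a position back along \<open>p\<close>. Since \<open>c\<close> is an involution,
  labeling \<open>v\<close> with \<open>l\<close> here mirrors labeling \<open>p v\<close> with
  \<open>c l\<close> in \<open>f\<close>.\<close>

definition act :: "('a \<rightharpoonup> nat) \<Rightarrow> ('a \<rightharpoonup> nat)" where
  "act f = (\<lambda>v. map_option c (f (p v)))"

lemma inj_p: "p u = p v \<longleftrightarrow> u = v"
  using bij_p by (meson bij_def inj_eq)

lemma c_inj: "c k = c l \<longleftrightarrow> k = l"
  by (metis c_c)

lemma c_le_iff: "c l \<le> card E \<longleftrightarrow> l \<le> card E"
  by (metis c_c c_le)

lemma act_upd: "act (f(p v \<mapsto> c l)) = (act f)(v \<mapsto> l)"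
  by (auto simp: act_def fun_eq_iff inj_p c_c)

lemma dom_act: "v \<in> dom (act f) \<longleftrightarrow> p v \<in> dom f"
  by (auto simp: act_def)

lemma ran_act: "l \<in> ran (act f) \<longleftrightarrow> c l \<in> ran f"
proof -
  obtain q where q: "\<And>v. p (q v) = v" using bij_p by (metis bij_pointE)
  show ?thesis
    unfolding act_def ran_def by (auto; metis q c_c)
qed

lemma distinct_edge_labels_act:
  assumes E': "\<And>e. e \<in> E' \<longleftrightarrow> p ` e \<in> E''"
    and dist: "\<And>u v. {u, v} \<in> E' \<Longrightarrow> \<bar>int (g u) - int (g v)\<bar> = \<bar>int (h (p u)) - int (h (p v))\<bar>"
  shows "distinct_edge_labels E' g \<longleftrightarrow> distinct_edge_labels E'' h"
proof -
  \<comment> \<open>Surjectivity of \<open>p\<close> lets a vertex quantifier range over images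
    only; it is applied to each of the four quantified vertices in turn.\<close>
  have surj: "(\<forall>u. P u) \<longleftrightarrow> (\<forall>u. P (p u))" for P
    using bij_p by (metis bij_pointE)
  have edge: "{p u, p v} \<in> E'' \<longleftrightarrow> {u, v} \<in> E'" for u v
    by (simp add: E')
  have "distinct_edge_labels E'' h \<longleftrightarrow>
    (\<forall>u v x y. {p u, p v} \<in> E'' \<and> {p x, p y} \<in> E'' \<and> {p u, p v} \<noteq> {p x, p y} \<longrightarrow>
      \<bar>int (h (p u)) - int (h (p v))\<bar> \<noteq> \<bar>int (h (p x)) - int (h (p y))\<bar>)"
    unfolding distinct_edge_labels_def
    by (subst surj, subst (2) surj, subst (3) surj, subst (4) surj) simp
  also have "\<dots> \<longleftrightarrow> distinct_edge_labels E' g"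
    unfolding distinct_edge_labels_def edge using dist by (simp add: doubleton_eq_iff inj_p)
  finally show ?thesis by simp
qed

text \<open>The bound on \<open>ran f\<close> enters because \<open>c\<close> is known to preserve
  differences only between admissible labels. If \<open>c l\<close> exceeds \<open>card E\<close>,
  both moves are illegal.\<close>

lemma legal_move_act:
  assumes ran_f: "ran f \<subseteq> {0..card E}"
  shows "legal_move V E (act f) (v, l) \<longleftrightarrow> legal_move V E f (p v, c l)"
proof (cases "c l \<le> card E")
  case True
  let ?f = "f(p v \<mapsto> c l)"
  have ran: "\<And>u k. ?f u = Some k \<Longrightarrow> k \<le> card E"
    using ran_f True by (auto simp: ran_def split: if_splits)
  have "distinct_edge_labels {e \<in> E. e \<subseteq> dom (act ?f)} (the \<circ> act ?f) \<longleftrightarrow>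
      distinct_edge_labels {e \<in> E. e \<subseteq> dom ?f} (the \<circ> ?f)"
  proof (rule distinct_edge_labels_act)
    show "e \<in> {e \<in> E. e \<subseteq> dom (act ?f)} \<longleftrightarrow> p ` e \<in> {e \<in> E. e \<subseteq> dom ?f}" for e
    proof -
      have "e \<subseteq> dom (act ?f) \<longleftrightarrow> p ` e \<subseteq> dom ?f"
        unfolding subset_eq dom_act by blast
      then show ?thesis using p_E by blast
    qed
  next
    fix u w assume "{u, w} \<in> {e \<in> E. e \<subseteq> dom (act ?f)}"
    then have "u \<in> dom (act ?f)" "w \<in> dom (act ?f)" by blast+
    then obtain j k where "?f (p u) = Some j" "?f (p w) = Some k"
      unfolding dom_act by blast
    then show "\<bar>int ((the \<circ> act ?f) u) - int ((the \<circ> act ?f) w)\<bar> =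
        \<bar>int ((the \<circ> ?f) (p u)) - int ((the \<circ> ?f) (p w))\<bar>"
      using c_dist ran by (simp add: act_def del: fun_upd_apply)
  qed
  then show ?thesis
    unfolding legal_move_def act_upd prod.case p_V dom_act ran_act atLeastAtMost_iff c_le_iff
    by blast
qed (simp add: legal_move_def c_le_iff)

lemma extendable_act:
  assumes "extendable V E f"
  shows "extendable V E (act f)"
proof -
  obtain g where g: "inj_on g V" "g ` V \<subseteq> {0..card E}" "distinct_edge_labels E g"
    and f: "\<And>v l. f v = Some l \<Longrightarrow> g v = l"
    using assms unfolding extendable_def graceful_labeling_def by blast
  have "distinct_edge_labels E (\<lambda>v. c (g (p v)))"
  proof (rule distinct_edge_labels_act[THEN iffD2, OF _ _ g(3)])
    show "e \<in> E \<longleftrightarrow> p ` e \<in> E" for e by (simp add: p_E)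
  next
    fix u v assume "{u, v} \<in> E"
    then have "u \<in> V" "v \<in> V" using E_V by blast+
    then have "p u \<in> V" "p v \<in> V" by (simp_all add: p_V)
    then have "g (p u) \<le> card E" "g (p v) \<le> card E" using g(2) by auto
    then show "\<bar>int (c (g (p u))) - int (c (g (p v)))\<bar> = \<bar>int (g (p u)) - int (g (p v))\<bar>"
      by (rule c_dist)
  qed
  moreover have "inj_on (\<lambda>v. c (g (p v))) V"
    using g(1) by (metis (mono_tags, lifting) inj_onI inj_onD c_inj p_V inj_p)
  moreover have "(\<lambda>v. c (g (p v))) ` V \<subseteq> {0..card E}"
    using g(2) p_V by (fastforce simp: c_le_iff)
  moreover have "c (g (p v)) = l" if "act f v = Some l" for v l
    using that f by (auto simp: act_def)
  ultimately show ?thesis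
    unfolding extendable_def graceful_labeling_def by blast
qed

text \<open>Induction on the derivation for the image position: Bob's moves are carried from
  \<open>act f\<close> to \<open>f\<close>, Alice's from \<open>f\<close> to
  \<open>act f\<close>.\<close>

lemma bob_wins_act:
  assumes "bob_wins V E q (act f)" "ran f \<subseteq> {0..card E}"
  shows "bob_wins V E q f"
  using assms
proof (induction q "act f" arbitrary: f rule: bob_wins.induct)
  case (doomed q)
  then show ?case using extendable_act bob_wins.doomed by blast
next
  case (Bob_moves v l)
  have legal: "legal_move V E f (p v, c l)"
    using Bob_moves by (simp add: legal_move_act)
  moreover have "bob_wins V E Alice (f(p v \<mapsto> c l))"
  proof (rule Bob_moves(3))
    show "(act f)(v \<mapsto> l) = act (f(p v \<mapsto> c l))" by (simp add: act_upd)
    show "ran (f(p v \<mapsto> c l)) \<subseteq> {0..card E}"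
      using legal Bob_moves.prems by (auto simp: legal_move_def ran_def split: if_splits)
  qed
  ultimately show ?case by (rule bob_wins.Bob_moves)
next
  case Alice_moves
  obtain q where q: "\<And>v. p (q v) = v" using bij_p by (metis bij_pointE)
  show ?case
  proof (rule bob_wins.Alice_moves)
    show "dom f \<noteq> V"
      using Alice_moves(1) dom_act p_V by blast
  next
    fix v l assume legal: "legal_move V E f (v, l)"
    have upd: "(act f)(q v \<mapsto> c l) = act (f(v \<mapsto> l))"
      using act_upd[of f "q v" "c l"] by (simp add: q c_c)
    have "legal_move V E (act f) (q v, c l)"
      using legal Alice_moves.prems by (simp add: legal_move_act q c_c)
    moreover have "ran (f(v \<mapsto> l)) \<subseteq> {0..card E}"
      using legal Alice_moves.prems by (auto simp: legal_move_def ran_def split: if_splits)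
    ultimately show "bob_wins V E Bob (f(v \<mapsto> l))"
      using Alice_moves(3) upd by blast
  qed
qed

end

section \<open>Cycles\<close>

text \<open>The successor modulo \<open>n\<close>, in conditional form so that case splits can
  decide adjacency.\<close>

definition cycle_succ :: "nat \<Rightarrow> nat \<Rightarrow> nat" where
  "cycle_succ n i = (if i + 1 = n then 0 else i + 1)"

definition cycle_adj :: "nat \<Rightarrow> nat \<Rightarrow> nat \<Rightarrow> bool" where
  "cycle_adj n i j \<longleftrightarrow> i < n \<and> j < n \<and> (j = cycle_succ n i \<or> i = cycle_succ n j)"

lemma cycle_succ_mod: "i < n \<Longrightarrow> (i + 1) mod n = cycle_succ n i"
  by (auto simp: cycle_succ_def)

lemma cycle_succ_less: "i < n \<Longrightarrow> cycle_succ n i < n"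
  by (auto simp: cycle_succ_def)

lemma cycle_edges_succ: "cycle_edges n = (\<lambda>i. {i, cycle_succ n i}) ` {..<n}"
proof -
  have "cycle_edges n = (\<lambda>i. {i, (i + 1) mod n}) ` {..<n}"
    by (auto simp: cycle_edges_def)
  also have "\<dots> = (\<lambda>i. {i, cycle_succ n i}) ` {..<n}"
    by (intro image_cong) (simp_all only: cycle_succ_mod lessThan_iff)
  finally show ?thesis .
qed

text \<open>Two distinct starting vertices give the same edge only if each succeeds the other, which
  would force \<open>n = 2\<close>.\<close>

lemma cycle_edge_inject:
  "\<lbrakk>n \<ge> 3; i < n; j < n; {i, cycle_succ n i} = {j, cycle_succ n j}\<rbrakk> \<Longrightarrow> i = j"
  by (auto simp: doubleton_eq_iff cycle_succ_def split: if_splits)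

text \<open>An edge is named by its starting vertex, which is unique for \<open>n \<ge> 3\<close>;
  absolute differences make its orientation irrelevant.\<close>

lemma distinct_edge_labels_cycle:
  assumes "n \<ge> 3"
  shows "distinct_edge_labels {e \<in> cycle_edges n. e \<subseteq> D} g \<longleftrightarrow>
    (\<forall>i<n. \<forall>j<n. i \<in> D \<and> cycle_succ n i \<in> D \<and> j \<in> D \<and> cycle_succ n j \<in> D \<and>
      \<bar>int (g i) - int (g (cycle_succ n i))\<bar> = \<bar>int (g j) - int (g (cycle_succ n j))\<bar> \<longrightarrow> i = j)"
    (is "?L \<longleftrightarrow> ?R")
proof
  assume L: ?L
  show ?R
  proof (intro allI impI, elim conjE)
    fix i j
    assume ij: "i < n" "j < n" "i \<in> D" "cycle_succ n i \<in> D" "j \<in> D" "cycle_succ n j \<in> D"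
      and eq: "\<bar>int (g i) - int (g (cycle_succ n i))\<bar> = \<bar>int (g j) - int (g (cycle_succ n j))\<bar>"
    have "{i, cycle_succ n i} \<in> {e \<in> cycle_edges n. e \<subseteq> D}"
      "{j, cycle_succ n j} \<in> {e \<in> cycle_edges n. e \<subseteq> D}"
      using ij by (auto simp: cycle_edges_succ)
    then have "{i, cycle_succ n i} = {j, cycle_succ n j}"
      using L[unfolded distinct_edge_labels_def, rule_format,
          of i "cycle_succ n i" j "cycle_succ n j"] eq by blast
    then show "i = j" using cycle_edge_inject assms ij by blast
  qed
next
  assume R: ?R
  have edge: "\<exists>i<n. i \<in> D \<and> cycle_succ n i \<in> D \<and> {u, v} = {i, cycle_succ n i} \<and>
      \<bar>int (g u) - int (g v)\<bar> = \<bar>int (g i) - int (g (cycle_succ n i))\<bar>"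
    if e: "{u, v} \<in> {e \<in> cycle_edges n. e \<subseteq> D}" for u v
  proof -
    obtain i where "i < n" "{u, v} = {i, cycle_succ n i}" "{u, v} \<subseteq> D"
      using e unfolding cycle_edges_succ by blast
    then show ?thesis
      by (intro exI[of _ i]) (auto simp: doubleton_eq_iff abs_minus_commute)
  qed
  show ?L
    unfolding distinct_edge_labels_def
  proof (intro allI impI notI, elim conjE)
    fix u v x y
    assume e: "{u, v} \<in> {e \<in> cycle_edges n. e \<subseteq> D}" "{x, y} \<in> {e \<in> cycle_edges n. e \<subseteq> D}"
      and ne: "{u, v} \<noteq> {x, y}" and eq: "\<bar>int (g u) - int (g v)\<bar> = \<bar>int (g x) - int (g y)\<bar>"
    show False
      using edge[OF e(1)] edge[OF e(2)] ne eq R by metis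
  qed
qed

lemma legal_move_cycle_iff:
  assumes "n \<ge> 3"
  shows "legal_move (cycle_verts n) (cycle_edges n) f (v, l) \<longleftrightarrow>
    v < n \<and> f v = None \<and> l \<le> n \<and> (\<forall>u. f u \<noteq> Some l) \<and>
    (\<forall>i j a b c d. i < n \<longrightarrow> j < n \<longrightarrow>
      (f(v \<mapsto> l)) i = Some a \<longrightarrow> (f(v \<mapsto> l)) (cycle_succ n i) = Some b \<longrightarrow>
      (f(v \<mapsto> l)) j = Some c \<longrightarrow> (f(v \<mapsto> l)) (cycle_succ n j) = Some d \<longrightarrow>
      \<bar>int a - int b\<bar> = \<bar>int c - int d\<bar> \<longrightarrow> i = j)"
  unfolding legal_move_def prod.case card_cycle_edges[OF assms] distinct_edge_labels_cycle[OF assms]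
  by (intro conj_cong) (auto simp: cycle_verts_def ran_def dom_def simp del: fun_upd_apply)

section \<open>Graceful labelings of cycles and their largest edge labels\<close>

abbreviation graceful_cycle :: "nat \<Rightarrow> (nat \<Rightarrow> nat) \<Rightarrow> bool" where
  "graceful_cycle n \<equiv> graceful_labeling (cycle_verts n) (cycle_edges n)"

lemma graceful_cycle_iff:
  assumes "n \<ge> 3"
  shows "graceful_cycle n g \<longleftrightarrow>
    inj_on g {..<n} \<and> (\<forall>i<n. g i \<le> n) \<and>
    (\<forall>i<n. \<forall>j<n. \<bar>int (g i) - int (g (cycle_succ n i))\<bar> = \<bar>int (g j) - int (g (cycle_succ n j))\<bar>
      \<longrightarrow> i = j)"
  using distinct_edge_labels_cycle[OF assms, of UNIV g] assms
  by (simp add: graceful_labeling_def card_cycle_edges cycle_verts_def lessThan_atLeast0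
      image_subset_iff Ball_def)

text \<open>A cycle has as many edges as there are possible edge labels, so each of them occurs.\<close>

lemma graceful_cycle_edge_label:
  assumes "n \<ge> 3" "graceful_cycle n g" "1 \<le> d" "d \<le> n"
  shows "\<exists>i j. cycle_adj n i j \<and> g i = g j + d"
proof -
  let ?lab = "\<lambda>i. nat \<bar>int (g i) - int (g (cycle_succ n i))\<bar>"
  have inj: "inj_on g {..<n}" and le: "\<And>i. i < n \<Longrightarrow> g i \<le> n"
    and dist: "\<And>i j. \<lbrakk>i < n; j < n;
      \<bar>int (g i) - int (g (cycle_succ n i))\<bar> = \<bar>int (g j) - int (g (cycle_succ n j))\<bar>\<rbrakk> \<Longrightarrow> i = j"
    using assms(2) unfolding graceful_cycle_iff[OF assms(1)] by blast+
  have "inj_on ?lab {..<n}"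
    using dist by (auto simp: inj_on_def)
  moreover have "?lab ` {..<n} \<subseteq> {1..n}"
  proof
    fix m assume "m \<in> ?lab ` {..<n}"
    then obtain i where i: "i < n" "m = ?lab i" by blast
    have "i \<noteq> cycle_succ n i" using assms(1) by (auto simp: cycle_succ_def)
    then have "g i \<noteq> g (cycle_succ n i)"
      using inj i(1) cycle_succ_less by (auto dest: inj_onD)
    then show "m \<in> {1..n}"
      using i le[OF i(1)] le[OF cycle_succ_less[OF i(1)]] by auto
  qed
  ultimately have "?lab ` {..<n} = {1..n}"
    by (intro card_subset_eq) (auto simp: card_image)
  then have "d \<in> ?lab ` {..<n}" using assms(3,4) by simp
  then obtain i where i: "i < n" "d = ?lab i" by blast
  have adj: "cycle_adj n i (cycle_succ n i)" "cycle_adj n (cycle_succ n i) i"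
    using i(1) by (auto simp: cycle_adj_def cycle_succ_less)
  show ?thesis
  proof (cases "g i \<ge> g (cycle_succ n i)")
    case True
    then have "g i = g (cycle_succ n i) + d" using i by auto
    then show ?thesis using adj by blast
  next
    case False
    then have "g (cycle_succ n i) = g i + d" using i by auto
    then show ?thesis using adj by blast
  qed
qed

lemma graceful_cycle_inj:
  "\<lbrakk>n \<ge> 3; graceful_cycle n g; i < n; j < n; g i = g j\<rbrakk> \<Longrightarrow> i = j"
  by (auto simp: graceful_cycle_iff dest: inj_onD)

lemma graceful_cycle_le: "\<lbrakk>n \<ge> 3; graceful_cycle n g; i < n\<rbrakk> \<Longrightarrow> g i \<le> n"
  by (simp add: graceful_cycle_iff)

text \<open>The edge label \<open>n\<close> can only arise between \<open>0\<close> and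
  \<open>n\<close>, and injectivity puts that \<open>0\<close> at \<open>z\<close>.\<close>

lemma graceful_cycle_neighbour_of_0:
  assumes "n \<ge> 3" "graceful_cycle n g" "z < n" "g z = 0"
  shows "\<exists>t. cycle_adj n t z \<and> g t = n"
proof -
  obtain i j where ij: "cycle_adj n i j" "g i = g j + n"
    using graceful_cycle_edge_label[OF assms(1,2), of n] assms(1) by auto
  then have "i < n" "j < n" by (auto simp: cycle_adj_def)
  then have "g j = 0" "g i = n"
    using graceful_cycle_le[OF assms(1,2), of i] ij(2) by auto
  then have "j = z" using graceful_cycle_inj[OF assms(1,2) \<open>j < n\<close> assms(3)] assms(4) by simp
  then show ?thesis using ij(1) \<open>g i = n\<close> by blast
qed

text \<open>A difference of \<open>n - 1\<close> leaves only the pairs \<open>0\<close>,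
  \<open>n - 1\<close> and \<open>1\<close>, \<open>n\<close>; injectivity puts \<open>0\<close> at
  \<open>z\<close> and \<open>n\<close> at \<open>t\<close>.\<close>

lemma graceful_cycle_second_largest:
  assumes "n \<ge> 3" "graceful_cycle n g" "z < n" "g z = 0" "t < n" "g t = n"
  shows "\<exists>k. cycle_adj n k z \<and> g k = n - 1 \<or> cycle_adj n t k \<and> g k = 1"
proof -
  have "1 \<le> n - 1" "n - 1 \<le> n" using assms(1) by simp_all
  then obtain i j where ij: "cycle_adj n i j" "g i = g j + (n - 1)"
    using graceful_cycle_edge_label[OF assms(1,2)] by blast
  then have less: "i < n" "j < n" by (auto simp: cycle_adj_def)
  then have "g i \<le> n" using graceful_cycle_le[OF assms(1,2)] by blast
  then consider "g j = 0" "g i = n - 1" | "g j = 1" "g i = n"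
    using ij(2) assms(1) by linarith
  then show ?thesis
  proof cases
    case 1
    then have "j = z" using graceful_cycle_inj[OF assms(1,2) less(2) assms(3)] assms(4) by simp
    then show ?thesis using 1 ij(1) by blast
  next
    case 2
    then have "i = t" using graceful_cycle_inj[OF assms(1,2) less(1) assms(5)] assms(6) by simp
    then show ?thesis using 2 ij(1) by blast
  qed
qed

section \<open>Doomed positions on cycles\<close>

abbreviation bob_wins_cycle :: "nat \<Rightarrow> player \<Rightarrow> (nat \<rightharpoonup> nat) \<Rightarrow> bool" where
  "bob_wins_cycle n \<equiv> bob_wins (cycle_verts n) (cycle_edges n)"

lemma doomedI:
  assumes "\<And>g. \<lbrakk>graceful_labeling V E g; \<And>v l. f v = Some l \<Longrightarrow> g v = l\<rbrakk> \<Longrightarrow> False"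
  shows "bob_wins V E q f"
  using assms by (intro bob_wins.doomed) (metis extendable_def)

lemma doomed_0_apart_from_n:
  assumes "n \<ge> 3" "z < n" "f z = Some 0" "f t = Some n" "t < n" "\<not> cycle_adj n t z"
  shows "bob_wins_cycle n q f"
proof (rule doomedI)
  fix g assume g: "graceful_cycle n g" and ext: "\<And>v l. f v = Some l \<Longrightarrow> g v = l"
  obtain t' where t': "cycle_adj n t' z" "g t' = n"
    using graceful_cycle_neighbour_of_0[OF assms(1) g assms(2) ext[OF assms(3)]] by blast
  then have "t' = t"
    using graceful_cycle_inj[OF assms(1) g, of t' t] ext[OF assms(4)] assms(5)
    by (auto simp: cycle_adj_def)
  then show False using t' assms(6) by blast
qed

text \<open>The label \<open>n\<close> has to sit next to \<open>0\<close>, but no place is left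
  there.\<close>

lemma doomed_neighbours_of_0:
  assumes "n \<ge> 3" "z < n" "f z = Some 0" "\<And>t. cycle_adj n t z \<Longrightarrow> \<exists>l. f t = Some l \<and> l \<noteq> n"
  shows "bob_wins_cycle n q f"
proof (rule doomedI)
  fix g assume g: "graceful_cycle n g" and ext: "\<And>v l. f v = Some l \<Longrightarrow> g v = l"
  obtain t where "cycle_adj n t z" "g t = n"
    using graceful_cycle_neighbour_of_0[OF assms(1) g assms(2) ext[OF assms(3)]] by blast
  then show False using assms(4) ext by blast
qed

text \<open>Both sources of the edge label \<open>n - 1\<close> are closed: the neighbours of
  \<open>0\<close> carry other labels, and \<open>1\<close> is fixed away from
  \<open>n\<close>.\<close>

lemma doomed_second_largest:
  assumes "n \<ge> 3" "z < n" "f z = Some 0" "t < n" "f t = Some n"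
    and "\<And>k. cycle_adj n k z \<Longrightarrow> \<exists>l. f k = Some l \<and> l \<noteq> n - 1"
    and "u < n" "f u = Some 1" "\<not> cycle_adj n t u"
  shows "bob_wins_cycle n q f"
proof (rule doomedI)
  fix g assume g: "graceful_cycle n g" and ext: "\<And>v l. f v = Some l \<Longrightarrow> g v = l"
  obtain k where "cycle_adj n k z \<and> g k = n - 1 \<or> cycle_adj n t k \<and> g k = 1"
    using graceful_cycle_second_largest[OF assms(1) g assms(2) ext[OF assms(3)] assms(4) ext[OF assms(5)]]
    by blast
  then show False
  proof
    assume "cycle_adj n k z \<and> g k = n - 1"
    then show False using assms(6) ext by blast
  next
    assume k: "cycle_adj n t k \<and> g k = 1"
    then have "k = u"
      using graceful_cycle_inj[OF assms(1) g, of k u] ext[OF assms(8)] assms(7)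
      by (auto simp: cycle_adj_def)
    then show False using k assms(9) by blast
  qed
qed

section \<open>Rotations of the cycle\<close>

definition cycle_rot :: "nat \<Rightarrow> nat \<Rightarrow> nat \<Rightarrow> nat" where
  "cycle_rot n k i = (if i < n then (i + k) mod n else i)"

lemma cycle_rot_inverse: "k \<le> n \<Longrightarrow> cycle_rot n (n - k) (cycle_rot n k i) = i"
proof -
  assume "k \<le> n"
  then have "((i + k) mod n + (n - k)) mod n = (i + n) mod n"
    by (metis add.assoc le_add_diff_inverse mod_add_left_eq)
  then show ?thesis by (simp add: cycle_rot_def)
qed

lemma cycle_rot_edge:
  assumes "e \<in> cycle_edges n"
  shows "cycle_rot n k ` e \<in> cycle_edges n"
proof -
  obtain i where i: "i < n" "e = {i, (i + 1) mod n}"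
    using assms by (auto simp: cycle_edges_def)
  then have "cycle_rot n k ` e = {(i + k) mod n, ((i + k) mod n + 1) mod n}"
    by (simp add: cycle_rot_def mod_simps)
  moreover have "(i + k) mod n < n" using i by simp
  ultimately show ?thesis by (auto simp: cycle_edges_def)
qed

text \<open>Rotation by \<open>n - k\<close> is the inverse. As \<open>cycle_rot\<close> fixes all
  numbers beyond the cycle, it permutes the whole type, as the locale demands.\<close>

lemma game_symmetry_cycle:
  assumes "n \<ge> 3" "k \<le> n" "\<And>l. c (c l) = l" "\<And>l. l \<le> n \<Longrightarrow> c l \<le> n"
    "\<And>l m. \<lbrakk>l \<le> n; m \<le> n\<rbrakk> \<Longrightarrow> \<bar>int (c l) - int (c m)\<bar> = \<bar>int l - int m\<bar>"
  shows "game_symmetry (cycle_verts n) (cycle_edges n) (cycle_rot n k) c"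
proof
  have inv: "cycle_rot n (n - k) (cycle_rot n k i) = i" "cycle_rot n k (cycle_rot n (n - k) i) = i" for i
    using cycle_rot_inverse[of k n i] cycle_rot_inverse[of "n - k" n i] assms(2) by auto
  then show "bij (cycle_rot n k)" by (metis bijI')
  show "cycle_rot n k ` e \<in> cycle_edges n \<longleftrightarrow> e \<in> cycle_edges n" for e
  proof
    assume "cycle_rot n k ` e \<in> cycle_edges n"
    then have "cycle_rot n (n - k) ` cycle_rot n k ` e \<in> cycle_edges n" by (rule cycle_rot_edge)
    then show "e \<in> cycle_edges n" by (simp add: image_image inv)
  qed (rule cycle_rot_edge)
  show "cycle_rot n k v \<in> cycle_verts n \<longleftrightarrow> v \<in> cycle_verts n" for v
    by (auto simp: cycle_rot_def cycle_verts_def)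
  show "e \<subseteq> cycle_verts n" if "e \<in> cycle_edges n" for e
    using that by (auto simp: cycle_verts_def cycle_edges_def)
qed (unfold card_cycle_edges[OF assms(1)], fact assms(3), fact assms(4), fact assms(5))

text \<open>Rotation brings the opening vertex to \<open>0\<close>, while \<open>c\<close> may
  replace the labels at the same time.\<close>

lemma bob_wins_cycle_first_move:
  assumes "n \<ge> 3" "v < n" "a \<le> n" "\<And>l. c (c l) = l" "\<And>l. l \<le> n \<Longrightarrow> c l \<le> n"
    "\<And>l m. \<lbrakk>l \<le> n; m \<le> n\<rbrakk> \<Longrightarrow> \<bar>int (c l) - int (c m)\<bar> = \<bar>int l - int m\<bar>"
    and win: "bob_wins_cycle n q [0 \<mapsto> c a]"
  shows "bob_wins_cycle n q [v \<mapsto> a]"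
proof -
  interpret game_symmetry "cycle_verts n" "cycle_edges n" "cycle_rot n v" c
    using assms(2) by (intro game_symmetry_cycle assms) simp_all
  have "cycle_rot n v 0 = v" using assms(1,2) by (simp add: cycle_rot_def)
  then have "act [v \<mapsto> a] = (act Map.empty)(0 \<mapsto> c a)"
    using act_upd[of Map.empty 0 "c a"] by (simp add: assms(4))
  then have "act [v \<mapsto> a] = [0 \<mapsto> c a]" by (simp add: act_def)
  with win have "bob_wins_cycle n q (act [v \<mapsto> a])" by (simp only:)
  moreover have "ran [v \<mapsto> a] \<subseteq> {0..card (cycle_edges n)}"
    using assms(1,3) by (simp add: card_cycle_edges)
  ultimately show ?thesis by (rule bob_wins_act)
qed

section \<open>Bob's strategies\<close>

text \<open>Equality of two edge labels is symmetric in the edges, so pairs with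
  \<open>i < j\<close> suffice.\<close>

lemma legal_move_cycleI:
  assumes "n \<ge> 3" "v < n" "f v = None" "l \<le> n" "\<And>u. f u \<noteq> Some l"
    and "\<And>i j a b c d. \<lbrakk>i < j; j < n;
      (f(v \<mapsto> l)) i = Some a; (f(v \<mapsto> l)) (cycle_succ n i) = Some b;
      (f(v \<mapsto> l)) j = Some c; (f(v \<mapsto> l)) (cycle_succ n j) = Some d\<rbrakk>
      \<Longrightarrow> \<bar>int a - int b\<bar> \<noteq> \<bar>int c - int d\<bar>"
  shows "legal_move (cycle_verts n) (cycle_edges n) f (v, l)"
  unfolding legal_move_cycle_iff[OF assms(1)]
proof (intro conjI allI impI)
  fix i j a b c d
  assume *: "i < n" "j < n" "(f(v \<mapsto> l)) i = Some a" "(f(v \<mapsto> l)) (cycle_succ n i) = Some b"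
    "(f(v \<mapsto> l)) j = Some c" "(f(v \<mapsto> l)) (cycle_succ n j) = Some d"
    "\<bar>int a - int b\<bar> = \<bar>int c - int d\<bar>"
  then show "i = j"
    using assms(6)[of i j a b c d] assms(6)[of j i c d a b] by (metis linorder_neqE_nat)
qed (use assms in auto)

text \<open>\<open>L\<close> tabulates the edge labels after the move. Positions are then split once
  per edge instead of once per pair of edges, and distinctness is checked on the table.\<close>

lemma legal_move_cycle_labelsI:
  assumes "n \<ge> 3" "v < n" "f v = None" "l \<le> n" "\<And>u. f u \<noteq> Some l"
    and L: "\<And>i a b. \<lbrakk>i < n; (f(v \<mapsto> l)) i = Some a; (f(v \<mapsto> l)) (cycle_succ n i) = Some b\<rbrakk>
      \<Longrightarrow> L i \<bar>int a - int b\<bar>"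
    and inj: "\<And>i j d. \<lbrakk>L i d; L j d\<rbrakk> \<Longrightarrow> i = j"
  shows "legal_move (cycle_verts n) (cycle_edges n) f (v, l)"
proof (rule legal_move_cycleI)
  fix i j a b c d
  assume *: "i < j" "j < n" "(f(v \<mapsto> l)) i = Some a" "(f(v \<mapsto> l)) (cycle_succ n i) = Some b"
    "(f(v \<mapsto> l)) j = Some c" "(f(v \<mapsto> l)) (cycle_succ n j) = Some d"
  have "L i \<bar>int a - int b\<bar>" using L[OF _ *(3,4)] *(1,2) by simp
  moreover have "L j \<bar>int c - int d\<bar>" using L[OF *(2,5,6)] .
  ultimately show "\<bar>int a - int b\<bar> \<noteq> \<bar>int c - int d\<bar>"
    using inj *(1) by force
qed (fact assms)+

lemma legal_move_cycleD:
  assumes "n \<ge> 3" "legal_move (cycle_verts n) (cycle_edges n) f (v, l)"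
  shows "v < n" "f v = None" "l \<le> n" "\<And>u. f u \<noteq> Some l"
  using assms(2) unfolding legal_move_cycle_iff[OF assms(1)] by blast+

lemma legal_move_cycle_distinct:
  assumes "n \<ge> 3" "legal_move (cycle_verts n) (cycle_edges n) f (v, l)" "i < n" "j < n" "i \<noteq> j"
    "(f(v \<mapsto> l)) i = Some a" "(f(v \<mapsto> l)) (cycle_succ n i) = Some b"
    "(f(v \<mapsto> l)) j = Some c" "(f(v \<mapsto> l)) (cycle_succ n j) = Some d"
  shows "\<bar>int a - int b\<bar> \<noteq> \<bar>int c - int d\<bar>"
  using assms(2-) unfolding legal_move_cycle_iff[OF assms(1)] by blast

section \<open>Cycles with at least five vertices\<close>

lemma bob_wins_cycle_Bob_first:
  assumes n: "n \<ge> 5"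
  shows "bob_wins_cycle n Bob Map.empty"
proof (rule bob_wins.Bob_moves)
  have n3: "n \<ge> 3" using n by simp
  show "legal_move (cycle_verts n) (cycle_edges n) Map.empty (0, 0)"
    by (rule legal_move_cycleI) (use n in \<open>auto simp: cycle_succ_def split: if_splits\<close>)
  show "bob_wins_cycle n Alice [0 \<mapsto> 0]"
  proof (rule bob_wins.Alice_moves)
    show "dom [0 \<mapsto> 0] \<noteq> cycle_verts n"
      using n by (auto simp: cycle_verts_def set_eq_iff intro!: exI[of _ 1])
    fix v l
    assume "legal_move (cycle_verts n) (cycle_edges n) [0 \<mapsto> 0] (v, l)"
    note legal = legal_move_cycleD[OF n3 this]
    then have vl: "v < n" "v \<noteq> 0" "l \<le> n" "l \<noteq> 0"
      using legal(4)[of 0] by (auto split: if_splits)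
    let ?f = "[0 \<mapsto> 0, v \<mapsto> l]"
    show "bob_wins_cycle n Bob ?f"
    proof (cases "l = n")
      case True
      show ?thesis
      proof (cases "v = 1 \<or> v = n - 1")
        case False
        then show ?thesis
          using vl True n by (intro doomed_0_apart_from_n[of n 0 _ v])
            (auto simp: cycle_adj_def cycle_succ_def split: if_splits)
      next
        case v: True
        \<comment> \<open>The other neighbour of the vertex labeled \<open>0\<close>. With
          \<open>1\<close> on it, both neighbours of \<open>0\<close> differ from
          \<open>n - 1\<close>, and \<open>1\<close> is not adjacent to \<open>n\<close>.\<close>
        define u where "u = n - v"
        have u: "u = 1 \<and> v = n - 1 \<or> u = n - 1 \<and> v = 1" using v n by (auto simp: u_def)
        show ?thesis
        proof (rule bob_wins.Bob_moves)
          show "legal_move (cycle_verts n) (cycle_edges n) ?f (u, 1)"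
            by (rule legal_move_cycleI)
              (use n u True in \<open>auto simp: cycle_succ_def split: if_splits\<close>)
          show "bob_wins_cycle n Alice (?f(u \<mapsto> 1))"
            by (rule doomed_second_largest[of n 0 _ v u])
              (use n u True in \<open>auto simp: cycle_adj_def cycle_succ_def split: if_splits\<close>)
        qed
      qed
    next
      case False
      \<comment> \<open>A free vertex not adjacent to vertex 0, chosen so that at most one edge has
        both ends labeled after \<open>n\<close> is placed there.\<close>
      define w where "w = (if v = 1 \<or> v = 2 then 3 else (2::nat))"
      show ?thesis
      proof (rule bob_wins.Bob_moves)
        show "legal_move (cycle_verts n) (cycle_edges n) ?f (w, n)"
          by (rule legal_move_cycleI)
            (use n vl False in \<open>auto simp: cycle_succ_def w_def split: if_splits\<close>)
        show "bob_wins_cycle n Alice (?f(w \<mapsto> n))"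
          by (rule doomed_0_apart_from_n[of n 0 _ w])
            (use n vl in \<open>auto simp: cycle_adj_def cycle_succ_def w_def split: if_splits\<close>)
      qed
    qed
  qed
qed

text \<open>Since \<open>a \<noteq> n\<close>, the label \<open>n\<close> can meet the
  \<open>0\<close> on vertex 1 only from vertex 2. The bound \<open>a < n - 1\<close> moreover keeps
  \<open>n - 1\<close> off vertex 0, which matters once \<open>n\<close> is on vertex 2.\<close>

lemma bob_wins_cycle_second_move:
  assumes n: "n \<ge> 5" and a: "0 < a" "a < n - 1"
  shows "bob_wins_cycle n Alice [0 \<mapsto> a, 1 \<mapsto> 0]"
proof (rule bob_wins.Alice_moves)
  have n3: "n \<ge> 3" using n by simp
  show "dom [0 \<mapsto> a, 1 \<mapsto> 0] \<noteq> cycle_verts n"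
    using n by (auto simp: cycle_verts_def set_eq_iff intro!: exI[of _ 2])
  fix v x
  assume legal: "legal_move (cycle_verts n) (cycle_edges n) [0 \<mapsto> a, 1 \<mapsto> 0] (v, x)"
  let ?f = "[0 \<mapsto> a, 1 \<mapsto> 0, v \<mapsto> x]"
  from legal have vx: "v < n" "v \<ge> 2" "x \<le> n" "x \<noteq> 0" "x \<noteq> a"
    using legal_move_cycleD(1-3)[OF n3 legal] legal_move_cycleD(4)[OF n3 legal, of 0]
      legal_move_cycleD(4)[OF n3 legal, of 1] by (auto split: if_splits)
  \<comment> \<open>Vertex \<open>n - 1\<close> is the other neighbour of vertex 0, so legality of
    Alice's move separates these two edge labels; used in case 7.\<close>
  have xa: "\<bar>int x - int a\<bar> \<noteq> int a" if "v = n - 1"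
  proof -
    have "(?f) 0 = Some a" "(?f) (cycle_succ n 0) = Some 0" "(?f) v = Some x"
      "(?f) (cycle_succ n v) = Some a"
      using n that by (auto simp: cycle_succ_def)
    then show ?thesis
      using legal_move_cycle_distinct[OF n3 legal, of v 0 x a a 0] vx(1,2) by simp
  qed
  \<comment> \<open>Cases 1, 2, 4 and 5 are already doomed; in the others Bob needs one more
    move.\<close>
  consider "v = 2" "x \<noteq> n" | "v = 2" "x = n" "a = 1" | "v = 2" "x = n" "a \<noteq> 1"
    | "v \<ge> 3" "x = n" | "v = 3" "x = n - a" | "v = 3" "x \<noteq> n" "x \<noteq> n - a" | "v \<ge> 4" "x \<noteq> n"
    using vx by linarith
  then show "bob_wins_cycle n Bob ?f"
  proof cases
    case 1
    then show ?thesis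
      using n a by (intro doomed_neighbours_of_0[of n 1])
        (auto simp: cycle_adj_def cycle_succ_def split: if_splits)
  next
    case 2
    then show ?thesis
      using n by (intro doomed_second_largest[of n 1 _ 2 0])
        (auto simp: cycle_adj_def cycle_succ_def split: if_splits)
  next
    \<comment> \<open>Vertex 4 is not adjacent to vertex 2, so \<open>1\<close> there excludes the
      edge label \<open>n - 1\<close>. It touches vertex 0 only for \<open>n = 5\<close>, which adds
      the edge label \<open>a - 1\<close>.\<close>
    case 3
    show ?thesis
    proof (rule bob_wins.Bob_moves)
      show "legal_move (cycle_verts n) (cycle_edges n) ?f (4, 1)"
      proof (rule legal_move_cycle_labelsI[where
            L = "\<lambda>i d. i = 0 \<and> d = int a \<or> i = 1 \<and> d = int n \<or> i = 4 \<and> n = 5 \<and> d = int a - 1"])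
        fix i b c
        assume "i < n" "(?f(4 \<mapsto> 1)) i = Some b" "(?f(4 \<mapsto> 1)) (cycle_succ n i) = Some c"
        then show "i = 0 \<and> \<bar>int b - int c\<bar> = int a \<or> i = 1 \<and> \<bar>int b - int c\<bar> = int n \<or>
            i = 4 \<and> n = 5 \<and> \<bar>int b - int c\<bar> = int a - 1"
          using n a(1) 3 by (auto simp: cycle_succ_def split: if_splits)
      next
        fix i j :: nat and d :: int
        assume "i = 0 \<and> d = int a \<or> i = 1 \<and> d = int n \<or> i = 4 \<and> n = 5 \<and> d = int a - 1"
          "j = 0 \<and> d = int a \<or> j = 1 \<and> d = int n \<or> j = 4 \<and> n = 5 \<and> d = int a - 1"
        then show "i = j" using a by (elim disjE conjE) simp_all
      qed (use n a 3 in \<open>auto split: if_splits\<close>)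
      show "bob_wins_cycle n Alice (?f(4 \<mapsto> 1))"
        by (rule doomed_second_largest[of n 1 _ 2 4])
          (use n a 3 in \<open>auto simp: cycle_adj_def cycle_succ_def split: if_splits\<close>)
    qed
  next
    case 4
    then show ?thesis
      using n vx by (intro doomed_0_apart_from_n[of n 1 _ v])
        (auto simp: cycle_adj_def cycle_succ_def split: if_splits)
  next
    case 5
    \<comment> \<open>Label \<open>n\<close> could only go to vertex 2, where it would repeat the edge label \<open>a\<close>.\<close>
    show ?thesis
    proof (rule doomedI)
      fix g assume g: "graceful_cycle n g" and ext: "\<And>v l. ?f v = Some l \<Longrightarrow> g v = l"
      have g': "g 0 = a" "g 1 = 0" "g 3 = n - a" using ext 5 by auto
      obtain t where t: "cycle_adj n t 1" "g t = n"
        using graceful_cycle_neighbour_of_0[OF n3 g, of 1] g' n by auto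
      then have "t = 0 \<or> t = 2" by (auto simp: cycle_adj_def cycle_succ_def split: if_splits)
      with t g' a have "g 2 = n" by auto
      with g' a have "\<bar>int (g 0) - int (g (cycle_succ n 0))\<bar> = \<bar>int (g 2) - int (g (cycle_succ n 2))\<bar>"
        using n by (simp add: cycle_succ_def numeral_3_eq_3 numeral_2_eq_2)
      then show False
        using g[unfolded graceful_cycle_iff[OF n3], THEN conjunct2, THEN conjunct2, rule_format, of 0 2] n
        by simp
    qed
  next
    case 6
    \<comment> \<open>Bob puts \<open>n\<close> on vertex 4, away from \<open>0\<close>. For
      \<open>n = 5\<close> this labels the edge to vertex 0 with \<open>n - a\<close>, and parity
      keeps it apart from \<open>a\<close>.\<close>
    have odd: "n - a \<noteq> a" if "n = 5" using that by presburger
    show ?thesis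
    proof (rule bob_wins.Bob_moves)
      show "legal_move (cycle_verts n) (cycle_edges n) ?f (4, n)"
      proof (rule legal_move_cycle_labelsI[where
            L = "\<lambda>i d. i = 0 \<and> d = int a \<or> i = 3 \<and> d = int n - int x \<or> i = 4 \<and> n = 5 \<and> d = int n - int a"])
        fix i b c
        assume "i < n" "(?f(4 \<mapsto> n)) i = Some b" "(?f(4 \<mapsto> n)) (cycle_succ n i) = Some c"
        then show "i = 0 \<and> \<bar>int b - int c\<bar> = int a \<or> i = 3 \<and> \<bar>int b - int c\<bar> = int n - int x \<or>
            i = 4 \<and> n = 5 \<and> \<bar>int b - int c\<bar> = int n - int a"
          using n a(2) vx(3) 6(1) by (auto simp: cycle_succ_def split: if_splits)
      next
        fix i j :: nat and d :: int
        assume "i = 0 \<and> d = int a \<or> i = 3 \<and> d = int n - int x \<or> i = 4 \<and> n = 5 \<and> d = int n - int a"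
          "j = 0 \<and> d = int a \<or> j = 3 \<and> d = int n - int x \<or> j = 4 \<and> n = 5 \<and> d = int n - int a"
        then show "i = j" using a vx(5) 6(3) odd by (elim disjE conjE) simp_all
      qed (use n a 6 vx(3) in \<open>auto split: if_splits\<close>)
      show "bob_wins_cycle n Alice (?f(4 \<mapsto> n))"
        by (rule doomed_0_apart_from_n[of n 1 _ 4])
          (use n 6 in \<open>auto simp: cycle_adj_def cycle_succ_def split: if_splits\<close>)
    qed
  next
    case 7
    \<comment> \<open>Bob blocks vertex 2 with a label other than \<open>n\<close>. Three values
      would repeat a vertex or edge label, so one of the four candidates remains, and
      \<open>n \<ge> 5\<close> keeps it below \<open>n\<close>.\<close>
    obtain y where y: "y \<in> {1..4}" "y \<notin> {a, x, nat \<bar>int x - int a\<bar>}"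
    proof -
      have "card {a, x, nat \<bar>int x - int a\<bar>} < card {1..4::nat}"
        by (auto simp: card_insert_if)
      then have "\<not> {1..4::nat} \<subseteq> {a, x, nat \<bar>int x - int a\<bar>}"
        by (meson card_mono finite.emptyI finite.insertI not_less)
      then show thesis using that by blast
    qed
    then have y': "y \<noteq> a" "y \<noteq> x" "1 \<le> y \<and> y \<le> 4" "int y \<noteq> \<bar>int x - int a\<bar>" by auto
    show ?thesis
    proof (rule bob_wins.Bob_moves)
      show "legal_move (cycle_verts n) (cycle_edges n) ?f (2, y)"
      proof (rule legal_move_cycle_labelsI[where
            L = "\<lambda>i d. i = 0 \<and> d = int a \<or> i = 1 \<and> d = int y \<or>
              i = v \<and> v = n - 1 \<and> d = \<bar>int x - int a\<bar>"])
        fix i b c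
        assume "i < n" "(?f(2 \<mapsto> y)) i = Some b" "(?f(2 \<mapsto> y)) (cycle_succ n i) = Some c"
        then show "i = 0 \<and> \<bar>int b - int c\<bar> = int a \<or> i = 1 \<and> \<bar>int b - int c\<bar> = int y \<or>
            i = v \<and> v = n - 1 \<and> \<bar>int b - int c\<bar> = \<bar>int x - int a\<bar>"
          using n 7(1) by (auto simp: cycle_succ_def split: if_splits)
      next
        fix i j :: nat and d :: int
        assume "i = 0 \<and> d = int a \<or> i = 1 \<and> d = int y \<or>
            i = v \<and> v = n - 1 \<and> d = \<bar>int x - int a\<bar>"
          "j = 0 \<and> d = int a \<or> j = 1 \<and> d = int y \<or>
            j = v \<and> v = n - 1 \<and> d = \<bar>int x - int a\<bar>"
        then show "i = j" using xa y'(1,4) by (elim disjE conjE) simp_all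
      qed (use n 7(1) vx y' in \<open>auto split: if_splits\<close>)
      show "bob_wins_cycle n Alice (?f(2 \<mapsto> y))"
        by (rule doomed_neighbours_of_0[of n 1])
          (use n a 7(1) y'(3) in \<open>auto simp: cycle_adj_def cycle_succ_def split: if_splits\<close>)
    qed
  qed
qed

text \<open>An extreme label is answered by the other extreme two steps away, any other label by an
  adjacent \<open>0\<close>. For \<open>a = n - 1\<close> that \<open>0\<close> would itself realize
  the edge label \<open>n - 1\<close>, hence the exclusion.\<close>

lemma bob_wins_cycle_after_label:
  assumes n: "n \<ge> 5" and a: "a \<le> n" "a \<noteq> n - 1"
  shows "bob_wins_cycle n Bob [0 \<mapsto> a]"
proof (cases "a = 0 \<or> a = n")
  case True
  show ?thesis
  proof (rule bob_wins.Bob_moves)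
    show "legal_move (cycle_verts n) (cycle_edges n) [0 \<mapsto> a] (2, n - a)"
      by (rule legal_move_cycleI) (use n True in \<open>auto simp: cycle_succ_def split: if_splits\<close>)
    show "bob_wins_cycle n Alice [0 \<mapsto> a, 2 \<mapsto> n - a]"
      using True n
      by (elim disjE; intro doomed_0_apart_from_n[of n "if a = 0 then 0 else 2" _ "if a = 0 then 2 else 0"])
        (auto simp: cycle_adj_def cycle_succ_def split: if_splits)
  qed
next
  case False
  show ?thesis
  proof (rule bob_wins.Bob_moves)
    show "legal_move (cycle_verts n) (cycle_edges n) [0 \<mapsto> a] (1, 0)"
      by (rule legal_move_cycleI) (use n False in \<open>auto simp: cycle_succ_def split: if_splits\<close>)
    show "bob_wins_cycle n Alice [0 \<mapsto> a, 1 \<mapsto> 0]"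
      using bob_wins_cycle_second_move[OF n, of a] False a by auto
  qed
qed

lemma bob_wins_cycle_Alice_first:
  assumes n: "n \<ge> 5"
  shows "bob_wins_cycle n Alice Map.empty"
proof (rule bob_wins.Alice_moves)
  have n3: "n \<ge> 3" using n by simp
  show "dom Map.empty \<noteq> cycle_verts n" using n by (auto simp: cycle_verts_def)
  fix v a
  assume "legal_move (cycle_verts n) (cycle_edges n) Map.empty (v, a)"
  then have va: "v < n" "a \<le> n" by (fact legal_move_cycleD[OF n3])+
  show "bob_wins_cycle n Bob [v \<mapsto> a]"
  proof (cases "a = n - 1")
    case False
    then show ?thesis
      using bob_wins_cycle_after_label[OF n va(2)]
      by (intro bob_wins_cycle_first_move[OF n3 va, where c = "\<lambda>l. l"]) auto
  next
    case True
    \<comment> \<open>Complementation turns \<open>n - 1\<close> into \<open>1\<close>, an opening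
      already covered. Labels above \<open>n\<close> are fixed to make \<open>?c\<close> an
      involution on all naturals.\<close>
    let ?c = "\<lambda>l. if l \<le> n then n - l else l"
    show ?thesis
      by (rule bob_wins_cycle_first_move[OF n3 va, where c = ?c])
        (use n True bob_wins_cycle_after_label[OF n, of 1] in \<open>auto simp: of_nat_diff\<close>)
  qed
qed

subsection \<open>The cycle on four vertices\<close>

text \<open>Exhaustive evaluation over the quadruples of labels, with \<open>a\<close> and
  \<open>c\<close> on opposite vertices and \<open>a\<close> and \<open>b\<close> on adjacent
  ones.\<close>

lemma distinct_differences_4:
  fixes a b c d :: int
  assumes "a \<in> {0..4}" "b \<in> {0..4}" "c \<in> {0..4}" "d \<in> {0..4}" "distinct [a, b, c, d]"
    and "distinct [\<bar>a - b\<bar>, \<bar>b - c\<bar>, \<bar>c - d\<bar>, \<bar>d - a\<bar>]"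
  shows "(a, c) \<in> {(0, 1), (1, 0), (0, 2), (2, 0), (2, 4), (4, 2), (3, 4), (4, 3)} \<and>
    (a = 1 \<longrightarrow> b \<noteq> 3)"
proof -
  have "\<forall>a\<in>{0, 1, 2, 3, 4::int}. \<forall>b\<in>{0, 1, 2, 3, 4}. \<forall>c\<in>{0, 1, 2, 3, 4}. \<forall>d\<in>{0, 1, 2, 3, 4}.
      distinct [a, b, c, d] \<longrightarrow> distinct [\<bar>a - b\<bar>, \<bar>b - c\<bar>, \<bar>c - d\<bar>, \<bar>d - a\<bar>] \<longrightarrow>
      (a, c) \<in> {(0, 1), (1, 0), (0, 2), (2, 0), (2, 4), (4, 2), (3, 4), (4, 3)} \<and>
      (a = 1 \<longrightarrow> b \<noteq> 3)"
    by simp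
  moreover have "{0..4} = {0, 1, 2, 3, 4::int}" by auto
  ultimately show ?thesis using assms by blast
qed

lemma graceful_cycle_4_opposite:
  assumes "graceful_cycle 4 g"
  shows "(g 0, g 2) \<in> {(0, 1), (1, 0), (0, 2), (2, 0), (2, 4), (4, 2), (3, 4), (4, 3)}"
    and "g 0 = 1 \<Longrightarrow> g 1 \<noteq> 3"
proof -
  have g: "inj_on g {..<4}" "\<And>i. i < 4 \<Longrightarrow> g i \<le> 4"
    and dist: "\<And>i j. \<lbrakk>i < 4; j < 4; i \<noteq> j\<rbrakk> \<Longrightarrow>
      \<bar>int (g i) - int (g (cycle_succ 4 i))\<bar> \<noteq> \<bar>int (g j) - int (g (cycle_succ 4 j))\<bar>"
    using assms by (auto simp: graceful_cycle_iff)
  have "distinct [int (g 0), int (g 1), int (g 2), int (g 3)]"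
    by (simp add: inj_on_eq_iff[OF g(1)])
  moreover have "distinct [\<bar>int (g 0) - int (g 1)\<bar>, \<bar>int (g 1) - int (g 2)\<bar>,
      \<bar>int (g 2) - int (g 3)\<bar>, \<bar>int (g 3) - int (g 0)\<bar>]"
    using dist[of 0 1] dist[of 0 2] dist[of 0 3] dist[of 1 2] dist[of 1 3] dist[of 2 3]
    by (simp add: cycle_succ_def flip: numeral_2_eq_2)
  moreover have "int (g 0) \<in> {0..4}" "int (g 1) \<in> {0..4}" "int (g 2) \<in> {0..4}" "int (g 3) \<in> {0..4}"
    using g(2)[of 0] g(2)[of 1] g(2)[of 2] g(2)[of 3] by auto
  ultimately have *: "(int (g 0), int (g 2)) \<in> {(0, 1), (1, 0), (0, 2), (2, 0), (2, 4), (4, 2), (3, 4), (4, 3)}"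
    "int (g 0) = 1 \<Longrightarrow> int (g 1) \<noteq> 3"
    using distinct_differences_4 by blast+
  from *(1) show "(g 0, g 2) \<in> {(0, 1), (1, 0), (0, 2), (2, 0), (2, 4), (4, 2), (3, 4), (4, 3)}"
    by auto
  from *(2) show "g 1 \<noteq> 3" if "g 0 = 1" using that by simp
qed

lemma doomed_4_opposite:
  assumes "f 0 = Some a" "f 2 = Some b"
    and "(a, b) \<notin> {(0, 1), (1, 0), (0, 2), (2, 0), (2, 4), (4, 2), (3, 4), (4, 3)}"
  shows "bob_wins_cycle 4 q f"
proof (rule doomedI)
  fix g assume "graceful_cycle 4 g" "\<And>v l. f v = Some l \<Longrightarrow> g v = l"
  then show False using graceful_cycle_4_opposite(1)[of g] assms by metis
qed

lemma bob_wins_cycle_4_Alice_first: "bob_wins_cycle 4 Alice Map.empty"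
proof (rule bob_wins.Alice_moves)
  show "dom Map.empty \<noteq> cycle_verts 4" by (auto simp: cycle_verts_def)
  fix v a
  assume legal: "legal_move (cycle_verts 4) (cycle_edges 4) Map.empty (v, a)"
  then have va: "v < 4" "a \<le> 4" by (auto dest: legal_move_cycleD(1,3)[rotated])
  \<comment> \<open>For each \<open>a\<close>, a different label such that \<open>(a, b)\<close> is
    missing from the list of opposite pairs. On opposite vertices the two labels complete no
    edge.\<close>
  define b where "b = (if a = 3 then 1 else if a = 4 then 0 else if a = 0 then 4 else (3::nat))"
  have "bob_wins_cycle 4 Bob [0 \<mapsto> a]"
  proof (rule bob_wins.Bob_moves)
    show "legal_move (cycle_verts 4) (cycle_edges 4) [0 \<mapsto> a] (2, b)"
      by (rule legal_move_cycleI) (auto simp: cycle_succ_def b_def split: if_splits)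
    show "bob_wins_cycle 4 Alice [0 \<mapsto> a, 2 \<mapsto> b]"
      by (rule doomed_4_opposite[of _ a b]) (use va in \<open>auto simp: b_def split: if_splits\<close>)
  qed
  then show "bob_wins_cycle 4 Bob [v \<mapsto> a]"
    by (intro bob_wins_cycle_first_move[OF _ va, where c = "\<lambda>l. l"]) simp_all
qed

text \<open>Bob opens with \<open>1\<close> because only \<open>0\<close> can stand opposite to it.
  If Alice puts \<open>0\<close> there herself, a \<open>3\<close> next to \<open>1\<close> is fatal
  instead.\<close>

lemma bob_wins_cycle_4_Bob_first: "bob_wins_cycle 4 Bob Map.empty"
proof (rule bob_wins.Bob_moves)
  show "legal_move (cycle_verts 4) (cycle_edges 4) Map.empty (0, 1)"
    by (rule legal_move_cycleI) (auto simp: cycle_succ_def split: if_splits)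
  show "bob_wins_cycle 4 Alice [0 \<mapsto> 1]"
  proof (rule bob_wins.Alice_moves)
    show "dom [0 \<mapsto> 1] \<noteq> cycle_verts 4"
      by (auto simp: cycle_verts_def set_eq_iff intro!: exI[of _ 1])
    fix v l
    assume "legal_move (cycle_verts 4) (cycle_edges 4) [0 \<mapsto> 1] (v, l)"
    note legal = legal_move_cycleD[OF _ this]
    then have vl: "v < 4" "v \<noteq> 0" "l \<le> 4" "l \<noteq> 1"
      using legal(4)[of 0] by (auto split: if_splits)
    let ?f = "[0 \<mapsto> 1, v \<mapsto> l]"
    consider "v = 2" "l = 0" | "v = 2" "l \<noteq> 0" | "v = 1 \<or> v = 3"
      using vl by linarith
    then show "bob_wins_cycle 4 Bob ?f"
    proof cases
      case 1
      show ?thesis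
      proof (rule bob_wins.Bob_moves)
        show "legal_move (cycle_verts 4) (cycle_edges 4) ?f (1, 3)"
          by (rule legal_move_cycleI) (use 1 in \<open>auto simp: cycle_succ_def split: if_splits\<close>)
        show "bob_wins_cycle 4 Alice (?f(1 \<mapsto> 3))"
        proof (rule doomedI)
          fix g assume "graceful_cycle 4 g" and ext: "\<And>v l. (?f(1 \<mapsto> 3)) v = Some l \<Longrightarrow> g v = l"
          moreover have "g 0 = 1" "g 1 = 3" using ext 1 by auto
          ultimately show False using graceful_cycle_4_opposite(2) by blast
        qed
      qed
    next
      case 2
      then show ?thesis using vl by (intro doomed_4_opposite[of _ 1 l]) auto
    next
      case 3
      define b where "b = (if l = 2 then 4 else if l = 3 then 2 else (3::nat))"
      show ?thesis
      proof (rule bob_wins.Bob_moves)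
        show "legal_move (cycle_verts 4) (cycle_edges 4) ?f (2, b)"
          by (rule legal_move_cycleI)
            (use 3 vl in \<open>auto simp: cycle_succ_def b_def split: if_splits\<close>)
        show "bob_wins_cycle 4 Alice (?f(2 \<mapsto> b))"
          by (rule doomed_4_opposite[of _ 1 b]) (use 3 in \<open>auto simp: b_def\<close>)
      qed
    qed
  qed
qed

section \<open>Alice's strategy on the triangle\<close>

lemma legal_play_position:
  assumes "legal_play V E ms"
  shows "dom (map_of ms) \<subseteq> V \<and> ran (map_of ms) \<subseteq> {0..card E} \<and>
    (\<forall>u v l. map_of ms u = Some l \<longrightarrow> map_of ms v = Some l \<longrightarrow> u = v) \<and>
    distinct_edge_labels {e \<in> E. e \<subseteq> dom (map_of ms)} (the \<circ> map_of ms)"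
  using assms
proof (induction ms rule: rev_induct)
  case Nil
  then show ?case by (auto simp: distinct_edge_labels_def)
next
  case (snoc mv ms)
  obtain v l where mv: "mv = (v, l)" by (cases mv)
  have legal: "legal_play V E ms" "legal_move V E (map_of ms) (v, l)"
    using snoc.prems mv by (simp_all add: legal_play_snoc)
  let ?f = "(map_of ms)(v \<mapsto> l)"
  have free: "v \<in> V" "v \<notin> dom (map_of ms)" "l \<le> card E" "l \<notin> ran (map_of ms)"
    and dist: "distinct_edge_labels {e \<in> E. e \<subseteq> dom ?f} (the \<circ> ?f)"
    using legal(2) by (auto simp: legal_move_def)
  have "dom ?f \<subseteq> V" "ran ?f \<subseteq> {0..card E}"
    using snoc.IH[OF legal(1)] free by (auto simp: ran_def)
  moreover have "\<forall>u w k. ?f u = Some k \<longrightarrow> ?f w = Some k \<longrightarrow> u = w"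
    using snoc.IH[OF legal(1)] free by (auto simp: ran_def)
  ultimately show ?case
    unfolding mv map_of_snoc[OF free(2)] using dist by blast
qed

text \<open>Legal moves keep the induced edge labels distinct, so once every vertex is labeled,
  legality alone makes the labeling graceful.\<close>

lemma winner_full_play:
  assumes "legal_play V E ms" "dom (map_of ms) = V" "\<And>e. e \<in> E \<Longrightarrow> e \<subseteq> V"
  shows "winner V E ms = Alice"
proof -
  note pos = legal_play_position[OF assms(1)]
  have "{e \<in> E. e \<subseteq> dom (map_of ms)} = E"
    using assms(2,3) by blast
  then have "distinct_edge_labels E (the \<circ> map_of ms)" using pos by simp
  moreover have "inj_on (the \<circ> map_of ms) V"
    using pos assms(2) by (fastforce simp: inj_on_def dom_def)
  moreover have "(the \<circ> map_of ms) ` V \<subseteq> {0..card E}"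
    using pos assms(2) by (fastforce simp: ran_def dom_def)
  ultimately show ?thesis
    using assms(2) by (simp add: winner_def graceful_labeling_def)
qed

text \<open>The gracefully labeled triangles carry the labels \<open>{0, 1, 3}\<close> or \<open>{0, 2, 3}\<close>; so the only
  pair of labels that blocks the last vertex is \<open>{1, 2}\<close>.\<close>

lemma triangle_legal_move:
  assumes free: "u < 3" "f u = None" and dom: "dom f \<subseteq> {..<3}" and le: "\<And>i k. f i = Some k \<Longrightarrow> k \<le> 3"
    and inj: "\<And>i j k. \<lbrakk>f i = Some k; f j = Some k\<rbrakk> \<Longrightarrow> i = j"
    and good: "f z = Some 0 \<or> f z = Some 3"
  shows "\<exists>l. legal_move (cycle_verts 3) (cycle_edges 3) f (u, l)"
proof -
  \<comment> \<open>Supplies a missing extreme label, or \<open>1\<close> if \<open>0\<close> and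
    \<open>3\<close> are both present, which completes the triangle to \<open>{0, 1, 3}\<close> or
    \<open>{0, 2, 3}\<close>.\<close>
  define l where "l = (if 0 \<notin> ran f then 0 else if 3 \<notin> ran f then 3 else (1::nat))"
  define p where "p = cycle_succ 3 u"
  define q where "q = cycle_succ 3 p"
  have succ: "cycle_succ 3 u = p" "cycle_succ 3 p = q" "cycle_succ 3 q = u"
    and ne: "p \<noteq> u" "q \<noteq> u" "p \<noteq> q" and all: "\<And>i. i < 3 \<Longrightarrow> i = u \<or> i = p \<or> i = q"
    using free(1) by (auto simp: p_def q_def cycle_succ_def)
  have pq: "i = p \<or> i = q" if "f i = Some k" for i k
  proof -
    have "i < 3" using that dom by (auto dest: domI)
    then show ?thesis using that free(2) all[of i] by auto
  qed
  have new: "f i \<noteq> Some l" for i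
  proof (cases "0 \<in> ran f \<and> 3 \<in> ran f")
    case True
    then obtain i0 i3 where "f i0 = Some 0" "f i3 = Some 3" by (auto simp: ran_def)
    with True show ?thesis using pq[of i0] pq[of i3] pq[of i 1] by (auto simp: l_def)
  next
    case False
    then show ?thesis by (auto simp: l_def ran_def)
  qed
  \<comment> \<open>Two edge labels can collide only if both other vertices are labeled; ten triples
    \<open>(x, y, l)\<close> then remain.\<close>
  have labels: "\<bar>int l - int x\<bar> \<noteq> \<bar>int y - int l\<bar>" "\<bar>int l - int x\<bar> \<noteq> \<bar>int x - int y\<bar>"
    "\<bar>int x - int y\<bar> \<noteq> \<bar>int y - int l\<bar>" if "f p = Some x" "f q = Some y" for x y
  proof -
    have ran: "k \<in> ran f \<longleftrightarrow> k = x \<or> k = y" for k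
    proof
      assume "k \<in> ran f"
      then obtain i where "f i = Some k" by (auto simp: ran_def)
      then show "k = x \<or> k = y" using pq[of i k] that by auto
    qed (use that in \<open>auto intro: ranI\<close>)
    have "x \<noteq> y" using inj that ne(3) by blast
    moreover have "x \<in> {0, 1, 2, 3}" "y \<in> {0, 1, 2, 3}"
      using le[OF that(1)] le[OF that(2)] by auto
    moreover have "x = 0 \<or> y = 0 \<or> x = 3 \<or> y = 3"
      using good ran[of 0] ran[of 3] by (auto dest: ranI)
    moreover have "l = (if x \<noteq> 0 \<and> y \<noteq> 0 then 0 else if x \<noteq> 3 \<and> y \<noteq> 3 then 3 else 1)"
      by (simp add: l_def ran)
    ultimately have "(x, y, l) \<in> {(0, 1, 3), (1, 0, 3), (0, 2, 3), (2, 0, 3), (0, 3, 1), (3, 0, 1),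
        (1, 3, 0), (3, 1, 0), (2, 3, 0), (3, 2, 0)}"
      by (elim insertE emptyE) simp_all
    then show "\<bar>int l - int x\<bar> \<noteq> \<bar>int y - int l\<bar>" "\<bar>int l - int x\<bar> \<noteq> \<bar>int x - int y\<bar>"
      "\<bar>int x - int y\<bar> \<noteq> \<bar>int y - int l\<bar>" by auto
  qed
  have "legal_move (cycle_verts 3) (cycle_edges 3) f (u, l)"
  proof (rule legal_move_cycleI)
    fix i j a b c d
    assume "i < j" "j < 3"
      and "(f(u \<mapsto> l)) i = Some a" "(f(u \<mapsto> l)) (cycle_succ 3 i) = Some b"
        "(f(u \<mapsto> l)) j = Some c" "(f(u \<mapsto> l)) (cycle_succ 3 j) = Some d"
    moreover have "i = u \<or> i = p \<or> i = q" "j = u \<or> j = p \<or> j = q"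
      using calculation(1,2) all by auto
    ultimately show "\<bar>int a - int b\<bar> \<noteq> \<bar>int c - int d\<bar>"
      using labels[of "the (f p)" "the (f q)"] ne by (auto simp: succ)
  qed (use free new in \<open>auto simp: l_def\<close>)
  then show ?thesis ..
qed

lemma Alice_wins_triangle:
  "has_winning_strategy (cycle_verts 3) (cycle_edges 3) first Alice"
proof -
  let ?legal = "legal_move (cycle_verts 3) (cycle_edges 3)"
  define good :: "nat move list \<Rightarrow> bool" where
    "good ms \<longleftrightarrow> (\<exists>z. map_of ms z = Some 0 \<or> map_of ms z = Some 3)" for ms
  \<comment> \<open>The exceptions cover the time up to Alice's first move: the empty board, and a
    single opening move by Bob with Alice to answer.\<close>
  define I where
    "I ms \<longleftrightarrow> good ms \<or> ms = [] \<or> (length ms = 1 \<and> to_move first ms = Alice)" for ms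
  have good_snoc: "good (ms @ [mv])" if "good ms" for ms mv
    using that unfolding good_def map_of_append by (meson map_add_find_right)
  have good_0: "good (ms @ [(v, 0)])" if "?legal (map_of ms) (v, 0)" for v ms
    using legal_move_cycleD(2)[OF _ that] by (auto simp: good_def map_add_def intro!: exI[of _ v])
  \<comment> \<open>With at most one vertex labeled, placing \<open>0\<close> completes at most one
    edge, so no edge label can repeat.\<close>
  have early: "\<exists>v. ?legal (map_of ms) (v, 0)"
    if early: "legal_play (cycle_verts 3) (cycle_edges 3) ms" "length ms \<le> 1" "\<not> good ms" for ms
  proof (cases ms)
    case Nil
    have "?legal Map.empty (0, 0)"
      by (rule legal_move_cycleI) (auto simp: cycle_succ_def split: if_splits)
    then show ?thesis using Nil by auto
  next
    case (Cons mv ms')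
    then obtain v x where ms: "ms = [(v, x)]" using early(2) by (cases mv) auto
    then have "x \<noteq> 0" using early(3) unfolding good_def by (auto dest: spec[of _ v])
    have "?legal (map_of []) (v, x)"
      using early(1) by (simp add: ms legal_play_def)
    from legal_move_cycleD(1)[OF _ this] have "v < 3" by simp
    then have "?legal [v \<mapsto> x] (cycle_succ 3 v, 0)"
      using \<open>x \<noteq> 0\<close> by (intro legal_move_cycleI) (auto simp: cycle_succ_def split: if_splits)
    then show ?thesis using ms by auto
  qed
  show ?thesis
  proof (rule has_winning_strategyI[where I = I])
    show "I []" by (simp add: I_def)
  next
    fix ms mv
    assume "legal_play (cycle_verts 3) (cycle_edges 3) ms" "I ms" "?legal (map_of ms) mv"
    then show "\<exists>mv'. ?legal (map_of ms) mv' \<and> I (ms @ [mv'])"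
      using early[of ms] good_0[of ms] good_snoc[of ms mv] unfolding I_def by fastforce
  next
    fix ms mv
    assume "I ms" "to_move first ms \<noteq> Alice"
    then show "I (ms @ [mv])"
      using good_snoc[of ms mv] unfolding I_def by (cases first) (auto simp: to_move_def)
  next
    fix ms
    assume fin: "finished_play (cycle_verts 3) (cycle_edges 3) ms" and "I ms"
    then have legal: "legal_play (cycle_verts 3) (cycle_edges 3) ms"
      and stuck: "\<And>mv. \<not> ?legal (map_of ms) mv"
      by (auto simp: finished_play_def)
    \<comment> \<open>In the exceptional clauses of \<open>I\<close>, \<open>early\<close> offers a
      legal move unless \<open>good\<close> holds, so a finished play must be good.\<close>
    have "good ms" using early[OF legal] stuck \<open>I ms\<close> unfolding I_def by fastforce
    then obtain z where z: "map_of ms z = Some 0 \<or> map_of ms z = Some 3"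
      by (auto simp: good_def)
    have pos: "dom (map_of ms) \<subseteq> cycle_verts 3" "ran (map_of ms) \<subseteq> {0..3}"
      "\<And>i j k. \<lbrakk>map_of ms i = Some k; map_of ms j = Some k\<rbrakk> \<Longrightarrow> i = j"
      using legal_play_position[OF legal] by (auto simp: card_cycle_edges)
    have le: "k \<le> 3" if "map_of ms i = Some k" for i k
      using ranI[of "map_of ms" i k] that pos(2) by auto
    have "dom (map_of ms) = cycle_verts 3"
    proof (rule ccontr)
      assume "dom (map_of ms) \<noteq> cycle_verts 3"
      then obtain u where "u \<in> cycle_verts 3" "u \<notin> dom (map_of ms)"
        using pos(1) by blast
      then have "u < 3" "map_of ms u = None" by (auto simp: cycle_verts_def)
      then show False
        using triangle_legal_move[of u "map_of ms" z] pos le z stuck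
        by (auto simp: cycle_verts_def lessThan_atLeast0)
    qed
    then show "winner (cycle_verts 3) (cycle_edges 3) ms = Alice"
      by (rule winner_full_play[OF legal]) (auto simp: cycle_edges_def cycle_verts_def)
  qed
qed

theorem theorem3:
  shows "(\<forall>n\<ge>4. \<forall>first. has_winning_strategy (cycle_verts n) (cycle_edges n) first Bob) \<and>
         (\<forall>first. has_winning_strategy (cycle_verts 3) (cycle_edges 3) first Alice)"
proof (intro conjI allI impI Alice_wins_triangle)
  fix n :: nat and first assume "n \<ge> 4"
  then have "bob_wins_cycle n q Map.empty" for q
    using bob_wins_cycle_Alice_first[of n] bob_wins_cycle_Bob_first[of n]
      bob_wins_cycle_4_Alice_first bob_wins_cycle_4_Bob_first
    by (cases "n = 4"; cases q) simp_all
  then show "has_winning_strategy (cycle_verts n) (cycle_edges n) first Bob"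
    by (rule bob_wins_has_winning_strategy)
qed

end
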